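(* Let $(E,d)$ be a complete SR metric space. Then every bounded sequence in $E$ has a polarly convergent subsequence.
   Context: For a subset $X$ of a metric space $(E,d)$, its Chebyshev radius is $\mathrm{rad}(X)=\inf_{x\in E}\sup_{y\in X}d(x,y)$. $B_\rho(x)$ denotes the ball of radius $\rho$ centered at $x$. A metric space $(E,d)$ is an SR ("Staples rotund") metric space if there exists a function $\delta:(0,\infty)^2\to(0,\infty)$ such that for all $r,\overline d>0$, setting $\delta=\delta(r,\overline d)$, for all $x,y\in E$ with $d(x,y)\ge\overline d$ one has $$\mathrm{rad}\big(B_{r+\delta}(x)\cap B_{r+\delta}(y)\big)\le r-\delta .$$ A sequence $(x_n)_{n\in\mathbb N}$ in $E$ polarly converges to $x\in E$ ($x$ is a polar limit of $(x_n)$) if for every $y\in E$ with $y\neq x$ there exists $M(y)\in\mathbb N$ such that $d(x_n,x)<d(x_n,y)$ for all $n\ge M(y)$. A sequence is polarly convergent if it polarly converges to some point of $E$. *)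

theory Defs
  imports "HOL-Analysis.Analysis"
begin

(* Extended reals keep the supremum meaningful for every X.  Here the radius of the empty set is
   -\<infinity>; in SR_metric_space the value 0 would give the same notion, since any witness
   \<delta> may be replaced by a smaller positive one. *)
definition chebyshev_rad :: "'a::metric_space set \<Rightarrow> ereal" where
  "chebyshev_rad X = (INF x. SUP y\<in>X. ereal (dist x y))"

(* The space E is the whole type 'a.  Shrinking \<delta> shows that open and closed balls give the
   same notion. *)
definition SR_metric_space :: "'a::metric_space itself \<Rightarrow> bool" where
  "SR_metric_space _ \<longleftrightarrow>
     (\<exists>\<delta> :: real \<Rightarrow> real \<Rightarrow> real. \<forall>r>0. \<forall>d>0. \<delta> r d > 0 \<and>
       (\<forall>x y :: 'a. dist x y \<ge> d \<longrightarrow>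
          chebyshev_rad (ball x (r + \<delta> r d) \<inter> ball y (r + \<delta> r d)) \<le> ereal (r - \<delta> r d)))"

definition polarly_converges :: "(nat \<Rightarrow> 'a::metric_space) \<Rightarrow> 'a \<Rightarrow> bool" where
  "polarly_converges u x \<longleftrightarrow>
     (\<forall>y. y \<noteq> x \<longrightarrow> (\<exists>M. \<forall>n\<ge>M. dist (u n) x < dist (u n) y))"

definition polarly_convergent :: "(nat \<Rightarrow> 'a::metric_space) \<Rightarrow> bool" where
  "polarly_convergent u \<longleftrightarrow> (\<exists>x. polarly_converges u x)"

end

theory Submission
  imports Defs "HOL-Library.Diagonal_Subsequence"
begin

text \<open>The proof goes through asymptotic centres. A bounded sequence has a subsequence whose
  asymptotic radius \<open>R\<close> does not drop on further subsequences. By the SR property, points whose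
  asymptotic distance to the sequence is close to \<open>R\<close> are close to each other, so by completeness
  there is exactly one point \<open>x\<close> at which \<open>R\<close> is attained. If some \<open>y \<noteq> x\<close> were infinitely often at
  least as close to the sequence as \<open>x\<close>, then \<open>x\<close> and \<open>y\<close> would be two asymptotic centres of
  the corresponding subsequence, whose asymptotic radius is still \<open>R\<close>.\<close>

section \<open>Asymptotic radius of a sequence\<close>

definition asymptotic_bounds :: "(nat \<Rightarrow> 'a::metric_space) \<Rightarrow> real set" where
  "asymptotic_bounds u = {r. \<exists>x. \<forall>\<^sub>F n in sequentially. dist (u n) x < r}"

text \<open>For bounded \<open>u\<close> this is the infimum over \<open>x\<close> of the limsup of
  \<open>dist (u n) x\<close>. Eventual strict bounds replace the limsup, so everything stays in the
  reals.\<close>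

definition asymptotic_radius :: "(nat \<Rightarrow> 'a::metric_space) \<Rightarrow> real" where
  "asymptotic_radius u = Inf (asymptotic_bounds u)"

lemma asymptotic_bounds_pos: "r \<in> asymptotic_bounds u \<Longrightarrow> 0 < r"
proof -
  assume "r \<in> asymptotic_bounds u"
  then obtain x N where "\<forall>n\<ge>N. dist (u n) x < r"
    by (auto simp: asymptotic_bounds_def eventually_sequentially)
  then have "dist (u N) x < r" by blast
  then show "0 < r" using zero_le_dist[of "u N" x] by linarith
qed

lemma bdd_below_asymptotic_bounds: "bdd_below (asymptotic_bounds u)"
  by (rule bdd_belowI[of _ 0]) (use asymptotic_bounds_pos less_imp_le in blast)

lemma asymptotic_bounds_nonempty:
  assumes "bounded (range u)"
  shows "asymptotic_bounds u \<noteq> {}"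
proof -
  obtain x e where "\<forall>n. dist x (u n) \<le> e"
    using assms by (auto simp: bounded_def)
  then have "\<forall>n. dist (u n) x < e + 1"
    by (metis dist_commute less_add_one order_le_less_trans)
  then have "e + 1 \<in> asymptotic_bounds u"
    unfolding asymptotic_bounds_def by (auto intro!: exI[of _ x])
  then show ?thesis by blast
qed

lemma asymptotic_bounds_subseq:
  assumes "strict_mono s"
  shows "asymptotic_bounds u \<subseteq> asymptotic_bounds (u \<circ> s)"
  unfolding asymptotic_bounds_def
  by (auto intro: eventually_subseq[OF assms])

lemma asymptotic_radius_nonneg:
  assumes "bounded (range u)"
  shows "0 \<le> asymptotic_radius u"
  unfolding asymptotic_radius_def
  by (rule cInf_greatest[OF asymptotic_bounds_nonempty[OF assms]])
    (use asymptotic_bounds_pos less_imp_le in blast)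

lemma bounded_range_comp: "bounded (range u) \<Longrightarrow> bounded (range (u \<circ> s))"
  by (rule bounded_subset) auto

lemma asymptotic_radius_subseq_le:
  assumes "bounded (range u)" "strict_mono s"
  shows "asymptotic_radius (u \<circ> s) \<le> asymptotic_radius u"
  unfolding asymptotic_radius_def
  by (rule cInf_superset_mono[OF asymptotic_bounds_nonempty[OF assms(1)]
        bdd_below_asymptotic_bounds asymptotic_bounds_subseq[OF assms(2)]])

lemma asymptotic_radius_le:
  assumes "\<forall>\<^sub>F n in sequentially. dist (u n) x < r"
  shows "asymptotic_radius u \<le> r"
  unfolding asymptotic_radius_def
  by (rule cInf_lower[OF _ bdd_below_asymptotic_bounds])
    (use assms in \<open>auto simp: asymptotic_bounds_def\<close>)

lemma asymptotic_radius_approx: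
  assumes "bounded (range u)" "0 < e"
  shows "\<exists>x. \<forall>\<^sub>F n in sequentially. dist (u n) x < asymptotic_radius u + e"
proof -
  have "Inf (asymptotic_bounds u) < asymptotic_radius u + e"
    using assms(2) by (simp add: asymptotic_radius_def)
  then obtain r where "r \<in> asymptotic_bounds u" "r < asymptotic_radius u + e"
    using cInf_lessD[OF asymptotic_bounds_nonempty[OF assms(1)]] by blast
  then obtain x where "\<forall>\<^sub>F n in sequentially. dist (u n) x < r"
    unfolding asymptotic_bounds_def by blast
  then have "\<forall>\<^sub>F n in sequentially. dist (u n) x < asymptotic_radius u + e"
    by (rule eventually_mono) (use \<open>r < asymptotic_radius u + e\<close> in linarith)
  then show ?thesis by blast
qed

text \<open>Only tails matter. The diagonal argument below uses this to discard initial
  terms.\<close>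

lemma asymptotic_radius_shift: "asymptotic_radius (u \<circ> (+) k) = asymptotic_radius u"
proof -
  have "(\<forall>\<^sub>F n in sequentially. dist (u (k + n)) x < r) \<longleftrightarrow>
      (\<forall>\<^sub>F n in sequentially. dist (u n) x < r)" for x r
    using eventually_sequentially_seg[of "\<lambda>n. dist (u n) x < r" k] by (simp add: add.commute)
  then show ?thesis
    by (simp add: asymptotic_radius_def asymptotic_bounds_def)
qed

section \<open>Subsequences with stable asymptotic radius\<close>

text \<open>Refinement can only lower the radius. Stage \<open>n\<close> leaves room for a further
  drop of at most 1/(n+1), and a diagonal sequence inherits all these bounds.\<close>

lemma regular_subsequence_exists:
  fixes u :: "nat \<Rightarrow> 'a::metric_space"
  assumes bdd: "bounded (range u)"
  obtains \<phi> :: "nat \<Rightarrow> nat" where "strict_mono \<phi>"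
    "\<And>s. strict_mono s \<Longrightarrow> asymptotic_radius (u \<circ> \<phi> \<circ> s) = asymptotic_radius (u \<circ> \<phi>)"
proof -
  define P where "P = (\<lambda>n (s :: nat \<Rightarrow> nat). \<forall>t. strict_mono t \<longrightarrow>
    asymptotic_radius (u \<circ> s) \<le> asymptotic_radius (u \<circ> s \<circ> t) + inverse (real (Suc n)))"
  have ex: "\<exists>r'. strict_mono r' \<and> P n (s \<circ> r')" for n and s :: "nat \<Rightarrow> nat"
  proof -
    \<comment> \<open>A choice of \<open>r'\<close> that nearly attains \<open>Inf A\<close> works:
      its own subsequences are still subsequences of \<open>u \<circ> s\<close>, so their radii
      cannot fall below \<open>Inf A\<close>.\<close>
    define A where "A = {asymptotic_radius (u \<circ> s \<circ> t) | t. strict_mono (t :: nat \<Rightarrow> nat)}"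
    have bA: "bdd_below A"
      unfolding A_def
      by (rule bdd_belowI[of _ 0]) (auto intro!: asymptotic_radius_nonneg bounded_range_comp bdd)
    have "asymptotic_radius (u \<circ> s \<circ> id) \<in> A"
      unfolding A_def using strict_mono_id by blast
    then have "A \<noteq> {}" by blast
    moreover have "Inf A < Inf A + inverse (real (Suc n))" by simp
    ultimately obtain a where "a \<in> A" and a: "a < Inf A + inverse (real (Suc n))"
      using cInf_lessD by blast
    then obtain r' :: "nat \<Rightarrow> nat" where r': "strict_mono r'" and
      "a = asymptotic_radius (u \<circ> s \<circ> r')"
      unfolding A_def by blast
    moreover have "Inf A \<le> asymptotic_radius (u \<circ> s \<circ> r' \<circ> t)" if "strict_mono t" for t
    proof (rule cInf_lower[OF _ bA])
      have "strict_mono (r' \<circ> t)" using r' that by (rule strict_mono_o)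
      then show "asymptotic_radius (u \<circ> s \<circ> r' \<circ> t) \<in> A"
        unfolding A_def by (auto simp: comp_assoc)
    qed
    ultimately have "P n (s \<circ> r')"
      using a unfolding P_def by (force simp: comp_assoc)
    then show ?thesis using r' by blast
  qed
  interpret subseqs P by unfold_locales (rule ex)
  \<comment> \<open>Passing to \<open>s \<circ> r\<close> lowers the left side of the bound, and its
    refinements are among those of \<open>s\<close>.\<close>
  have hered: "P n (s \<circ> r)" if r: "strict_mono r" and P: "P n s" for r s n
    unfolding P_def
  proof (intro allI impI)
    fix t :: "nat \<Rightarrow> nat" assume t: "strict_mono t"
    have "asymptotic_radius (u \<circ> (s \<circ> r)) \<le> asymptotic_radius (u \<circ> s)"
      using asymptotic_radius_subseq_le[OF bounded_range_comp[OF bdd] r] by (simp add: comp_assoc)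
    also have "\<dots> \<le> asymptotic_radius (u \<circ> s \<circ> (r \<circ> t)) + inverse (real (Suc n))"
      using P strict_mono_o[OF r t] unfolding P_def by blast
    finally show "asymptotic_radius (u \<circ> (s \<circ> r))
        \<le> asymptotic_radius (u \<circ> (s \<circ> r) \<circ> t) + inverse (real (Suc n))"
      by (simp add: comp_assoc)
  qed
  have "asymptotic_radius (u \<circ> diagseq \<circ> s) = asymptotic_radius (u \<circ> diagseq)"
    if s: "strict_mono s" for s
  proof (rule antisym)
    show "asymptotic_radius (u \<circ> diagseq \<circ> s) \<le> asymptotic_radius (u \<circ> diagseq)"
      using asymptotic_radius_subseq_le[OF bounded_range_comp[OF bdd] s] .
    show "asymptotic_radius (u \<circ> diagseq) \<le> asymptotic_radius (u \<circ> diagseq \<circ> s)"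
    proof (rule field_le_epsilon)
      fix e :: real assume "0 < e"
      then obtain k where k: "inverse (real (Suc k)) < e"
        using reals_Archimedean by blast
      \<comment> \<open>The diagonal is known to refine stage \<open>Suc k\<close> only from index
        \<open>Suc k\<close> on, so the bound is available for that tail.\<close>
      have Pk: "P k (diagseq \<circ> (+) (Suc k))"
        by (rule diagseq_holds) (rule hered)
      \<comment> \<open>\<open>t\<close> is \<open>s\<close> re-indexed to act on the tail. The
        natural subtraction does not truncate, because \<open>s m\<close> is at least
        \<open>m\<close>.\<close>
      define t where "t = (\<lambda>n. s (Suc k + n) - Suc k)"
      have ge: "Suc k + n \<le> s (Suc k + n)" for n
        using s by (rule strict_mono_imp_increasing)
      have "strict_mono t"
      proof (rule strict_monoI)
        fix m n :: nat assume "m < n"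
        then have "s (Suc k + m) < s (Suc k + n)"
          using s by (simp add: strict_mono_less)
        then show "t m < t n"
          unfolding t_def using ge[of m] by linarith
      qed
      then have "asymptotic_radius (u \<circ> (diagseq \<circ> (+) (Suc k)))
        \<le> asymptotic_radius (u \<circ> (diagseq \<circ> (+) (Suc k)) \<circ> t) + inverse (real (Suc k))"
        using Pk unfolding P_def by blast
      moreover have "u \<circ> (diagseq \<circ> (+) (Suc k)) \<circ> t = u \<circ> diagseq \<circ> ((+) (Suc k) \<circ> t)"
        by (simp only: comp_assoc)
      moreover have "(+) (Suc k) \<circ> t = s \<circ> (+) (Suc k)"
      proof
        fix n
        show "((+) (Suc k) \<circ> t) n = (s \<circ> (+) (Suc k)) n"
          using ge[of n] by (simp add: t_def)
      qed
      ultimately have "asymptotic_radius (u \<circ> diagseq \<circ> (+) (Suc k))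
        \<le> asymptotic_radius (u \<circ> diagseq \<circ> s \<circ> (+) (Suc k)) + inverse (real (Suc k))"
        by (simp only: comp_assoc)
      then show "asymptotic_radius (u \<circ> diagseq) \<le> asymptotic_radius (u \<circ> diagseq \<circ> s) + e"
        using k unfolding asymptotic_radius_shift by linarith
    qed
  qed
  then show thesis using that[OF subseq_diagseq] by blast
qed

section \<open>Asymptotic centres in SR spaces\<close>

text \<open>If \<open>x\<close> and \<open>y\<close> were at least \<open>e\<close> apart, the
  sequence would eventually lie in the intersection of two balls of small Chebyshev radius, and a
  near-centre of that intersection would beat the asymptotic radius.\<close>

lemma SR_almost_centers_close:
  fixes u :: "nat \<Rightarrow> 'a::metric_space"
  assumes SR: "SR_metric_space TYPE('a)" and bdd: "bounded (range u)" and e: "0 < e"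
  obtains \<eta> where "0 < \<eta>"
    "\<And>x y. \<forall>\<^sub>F n in sequentially. dist (u n) x < asymptotic_radius u + \<eta> \<Longrightarrow>
      \<forall>\<^sub>F n in sequentially. dist (u n) y < asymptotic_radius u + \<eta> \<Longrightarrow> dist x y < e"
\<comment> \<open>The SR condition concerns only r > 0; at radius 0 the triangle inequality
  suffices.\<close>
proof (cases "asymptotic_radius u = 0")
  case True
  have "dist x y < e"
    if "\<forall>\<^sub>F n in sequentially. dist (u n) x < e / 2"
      and "\<forall>\<^sub>F n in sequentially. dist (u n) y < e / 2" for x y
  proof -
    have "\<forall>\<^sub>F n in sequentially. dist x y < e"
      using that by eventually_elim (metis dist_commute dist_triangle_half_l)
    then show ?thesis by simp
  qed
  with True that[of "e / 2"] e show thesis by simp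
next
  case False
  define R where "R = asymptotic_radius u"
  have "0 < R"
    using False asymptotic_radius_nonneg[OF bdd] by (simp add: R_def)
  then obtain \<delta> where \<delta>: "0 < \<delta>" and rad: "\<And>x y :: 'a. e \<le> dist x y \<Longrightarrow>
      chebyshev_rad (ball x (R + \<delta>) \<inter> ball y (R + \<delta>)) \<le> ereal (R - \<delta>)"
    using SR e unfolding SR_metric_space_def by meson
  have "dist x y < e"
    if x: "\<forall>\<^sub>F n in sequentially. dist (u n) x < R + \<delta>"
      and y: "\<forall>\<^sub>F n in sequentially. dist (u n) y < R + \<delta>" for x y
  proof (rule ccontr)
    assume "\<not> dist x y < e"
    then have "chebyshev_rad (ball x (R + \<delta>) \<inter> ball y (R + \<delta>)) \<le> ereal (R - \<delta>)"
      by (intro rad) simp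
    \<comment> \<open>The infimum in \<open>chebyshev_rad\<close> need not be attained. Giving up
      half of \<open>\<delta>\<close> yields an actual point \<open>z\<close> and still a bound
      below \<open>R\<close>.\<close>
    also have "\<dots> < ereal (R - \<delta> / 2)" using \<delta> by simp
    finally obtain z where z:
      "(SUP w\<in>ball x (R + \<delta>) \<inter> ball y (R + \<delta>). ereal (dist z w)) < ereal (R - \<delta> / 2)"
      unfolding chebyshev_rad_def by (auto simp: INF_less_iff)
    have "\<forall>\<^sub>F n in sequentially. dist (u n) z < R - \<delta> / 2"
      using x y
    proof eventually_elim
      case (elim n)
      then have "u n \<in> ball x (R + \<delta>) \<inter> ball y (R + \<delta>)" by (simp add: dist_commute)
      then have "ereal (dist z (u n)) < ereal (R - \<delta> / 2)"
        using z by (meson SUP_upper order_le_less_trans)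
      then show ?case by (simp add: dist_commute)
    qed
    then have "R \<le> R - \<delta> / 2" unfolding R_def by (rule asymptotic_radius_le)
    with \<delta> show False by simp
  qed
  with \<delta> show thesis using that[of \<delta>] unfolding R_def by blast
qed

text \<open>For bounded \<open>u\<close>, these are the points attaining the infimum that defines
  the radius. The slack \<open>e\<close> turns the non-strict limsup bound into strict eventual
  ones.\<close>

definition asymptotic_center :: "(nat \<Rightarrow> 'a::metric_space) \<Rightarrow> 'a \<Rightarrow> bool" where
  "asymptotic_center u x \<longleftrightarrow>
    (\<forall>e>0. \<forall>\<^sub>F n in sequentially. dist (u n) x < asymptotic_radius u + e)"

text \<open>Two distinct centres are almost-centres for every tolerance, so their distance would be
  smaller than itself.\<close>

lemma SR_asymptotic_center_unique:
  fixes u :: "nat \<Rightarrow> 'a::metric_space"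
  assumes "SR_metric_space TYPE('a)" "bounded (range u)"
    and "asymptotic_center u x" "asymptotic_center u y"
  shows "x = y"
proof (rule ccontr)
  assume "x \<noteq> y"
  then obtain \<eta> where "0 < \<eta>" "\<And>a b. \<forall>\<^sub>F n in sequentially. dist (u n) a < asymptotic_radius u + \<eta> \<Longrightarrow>
      \<forall>\<^sub>F n in sequentially. dist (u n) b < asymptotic_radius u + \<eta> \<Longrightarrow> dist a b < dist x y"
    using SR_almost_centers_close[OF assms(1,2), of "dist x y"] by (metis zero_less_dist_iff)
  then have "dist x y < dist x y"
    using assms(3,4) unfolding asymptotic_center_def by blast
  then show False by simp
qed

text \<open>Almost-centres with tolerances tending to 0 form a Cauchy sequence by the closeness
  lemma, and their limit is a centre.\<close>

lemma SR_asymptotic_center_exists: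
  fixes u :: "nat \<Rightarrow> 'a::complete_space"
  assumes SR: "SR_metric_space TYPE('a)" and bdd: "bounded (range u)"
  shows "\<exists>x. asymptotic_center u x"
proof -
  have "\<exists>x. \<forall>\<^sub>F n in sequentially. dist (u n) x < asymptotic_radius u + inverse (real (Suc k))" for k
    by (rule asymptotic_radius_approx[OF bdd]) simp
  then obtain c where c:
    "\<And>k. \<forall>\<^sub>F n in sequentially. dist (u n) (c k) < asymptotic_radius u + inverse (real (Suc k))"
    by metis
  \<comment> \<open>The threshold in \<open>n\<close> may depend on \<open>k\<close>; only
    \<open>N\<close> is uniform.\<close>
  have c_small: "\<exists>N. \<forall>k\<ge>N. \<forall>\<^sub>F n in sequentially. dist (u n) (c k) < asymptotic_radius u + e"
    if "0 < e" for e
  proof -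
    obtain N where N: "inverse (real (Suc N)) < e" using reals_Archimedean[OF \<open>0 < e\<close>] by blast
    have "\<forall>\<^sub>F n in sequentially. dist (u n) (c k) < asymptotic_radius u + e" if "N \<le> k" for k
    proof -
      have "inverse (real (Suc k)) \<le> inverse (real (Suc N))"
        using that by (simp add: le_imp_inverse_le)
      with N have "inverse (real (Suc k)) < e" by linarith
      then show ?thesis by (intro eventually_mono[OF c[of k]]) linarith
    qed
    then show ?thesis by blast
  qed
  have "Cauchy c"
  proof (rule metric_CauchyI)
    fix e :: real assume "0 < e"
    then obtain \<eta> where "0 < \<eta>" and \<eta>: "\<And>a b. \<forall>\<^sub>F n in sequentially. dist (u n) a < asymptotic_radius u + \<eta> \<Longrightarrow>
      \<forall>\<^sub>F n in sequentially. dist (u n) b < asymptotic_radius u + \<eta> \<Longrightarrow> dist a b < e"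
      using SR_almost_centers_close[OF SR bdd] by metis
    then show "\<exists>N. \<forall>m\<ge>N. \<forall>n\<ge>N. dist (c m) (c n) < e"
      using c_small[OF \<open>0 < \<eta>\<close>] by meson
  qed
  then obtain x where x: "c \<longlonglongrightarrow> x"
    using Cauchy_convergent_iff convergent_def by blast
  have "\<forall>\<^sub>F n in sequentially. dist (u n) x < asymptotic_radius u + e" if "0 < e" for e
  proof -
    obtain N where N: "\<forall>k\<ge>N. \<forall>\<^sub>F n in sequentially. dist (u n) (c k) < asymptotic_radius u + e / 2"
      using c_small[OF half_gt_zero[OF \<open>0 < e\<close>]] by blast
    obtain M where M: "\<forall>k\<ge>M. dist (c k) x < e / 2"
      using metric_LIMSEQ_D[OF x half_gt_zero[OF \<open>0 < e\<close>]] by blast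
    \<comment> \<open>One fixed almost-centre close to \<open>x\<close> is enough, so no uniformity
      in \<open>k\<close> is required.\<close>
    have "\<forall>\<^sub>F n in sequentially. dist (u n) (c (max N M)) < asymptotic_radius u + e / 2"
      using N by simp
    then show ?thesis
    proof eventually_elim
      case (elim n)
      have "dist (c (max N M)) x < e / 2" using M by simp
      with elim show ?case
        using dist_triangle[of "u n" x "c (max N M)"] by linarith
    qed
  qed
  then show ?thesis unfolding asymptotic_center_def by blast
qed

section \<open>From asymptotic centres to polar limits\<close>

lemma SR_regular_center_polar_limit:
  fixes v :: "nat \<Rightarrow> 'a::metric_space"
  assumes SR: "SR_metric_space TYPE('a)" and bdd: "bounded (range v)"
    and regular: "\<And>s. strict_mono s \<Longrightarrow> asymptotic_radius (v \<circ> s) = asymptotic_radius v"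
    and x: "asymptotic_center v x"
  shows "polarly_converges v x"
  unfolding polarly_converges_def
proof (intro allI impI)
  fix y assume "y \<noteq> x"
  show "\<exists>M. \<forall>n\<ge>M. dist (v n) x < dist (v n) y"
  proof (rule ccontr)
    assume "\<not> (\<exists>M. \<forall>n\<ge>M. dist (v n) x < dist (v n) y)"
    then have "infinite {n. dist (v n) y \<le> dist (v n) x}"
      unfolding infinite_nat_iff_unbounded_le by (auto simp: not_less)
    then obtain s :: "nat \<Rightarrow> nat" where s: "strict_mono s" and
      closer: "\<And>n. dist (v (s n)) y \<le> dist (v (s n)) x"
      using infinite_enumerate by blast
    \<comment> \<open>Regularity enters here: a smaller radius along \<open>s\<close> could stop
      \<open>x\<close> from being a centre of \<open>v \<circ> s\<close>.\<close>
    have cx: "asymptotic_center (v \<circ> s) x"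
      using x s eventually_subseq[OF s] regular[OF s] unfolding asymptotic_center_def by fastforce
    have "asymptotic_center (v \<circ> s) y"
      unfolding asymptotic_center_def
    proof (intro allI impI)
      fix e :: real assume "0 < e"
      with cx have "\<forall>\<^sub>F n in sequentially. dist ((v \<circ> s) n) x < asymptotic_radius (v \<circ> s) + e"
        unfolding asymptotic_center_def by blast
      then show "\<forall>\<^sub>F n in sequentially. dist ((v \<circ> s) n) y < asymptotic_radius (v \<circ> s) + e"
        by (rule eventually_mono) (simp add: order_le_less_trans[OF closer])
    qed
    then show False
      using SR_asymptotic_center_unique[OF SR bounded_range_comp[OF bdd] cx] \<open>y \<noteq> x\<close> by blast
  qed
qed

theorem theorem3p4:
  fixes u :: "nat \<Rightarrow> 'a::complete_space"
  assumes "SR_metric_space TYPE('a)"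
    and "bounded (range u)"
  shows "\<exists>\<phi> :: nat \<Rightarrow> nat. strict_mono \<phi> \<and> polarly_convergent (u \<circ> \<phi>)"
proof -
  obtain \<phi> :: "nat \<Rightarrow> nat" where \<phi>: "strict_mono \<phi>"
    and regular: "\<And>s. strict_mono s \<Longrightarrow>
      asymptotic_radius (u \<circ> \<phi> \<circ> s) = asymptotic_radius (u \<circ> \<phi>)"
    using regular_subsequence_exists[OF assms(2)] by blast
  have bdd: "bounded (range (u \<circ> \<phi>))"
    using assms(2) by (rule bounded_range_comp)
  obtain x where "asymptotic_center (u \<circ> \<phi>) x"
    using SR_asymptotic_center_exists[OF assms(1) bdd] by blast
  then have "polarly_converges (u \<circ> \<phi>) x"
    using SR_regular_center_polar_limit[OF assms(1) bdd] regular by blast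
  then show ?thesis
    using \<phi> unfolding polarly_convergent_def by blast
qed

end
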